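(* Let $p$ be an odd prime number. Then $$\frac{B_{p+1}(p+1)+B_{p+1}(p)-2B_{p+1}}{p(p+1)}\equiv p^{p-1}\pmod p .$$
   Context: $B_n(x)=\sum_{k=0}^n\binom{n}{k}B_k\,x^{n-k}$ is the $n$-th Bernoulli polynomial, where $B_k$ are the Bernoulli numbers (with $B_1=-1/2$); $B_{p+1}$ without argument denotes the Bernoulli number $B_{p+1}=B_{p+1}(0)$. For rational numbers $a,b$, the congruence $a\equiv b\pmod p$ means that $a-b$ is an integer multiple of $p$. The fraction on the left-hand side is an ordinary rational number. *)

theory Defs
  imports Complex_Main "HOL-Computational_Algebra.Primes"
begin

(* Standard recurrence: sum over k <= n of (n+1 choose k) * B_k equals 0 for n > 0.
   It fixes the convention B_1 = -1/2. *)
fun bernoulli :: "nat \<Rightarrow> rat" where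
  "bernoulli 0 = 1"
| "bernoulli (Suc n) =
     - (\<Sum>k\<le>n. of_nat (Suc (Suc n) choose k) * bernoulli k) / of_nat (Suc (Suc n))"

definition bernoulli_poly :: "nat \<Rightarrow> rat \<Rightarrow> rat" where
  "bernoulli_poly n x = (\<Sum>k=0..n. of_nat (n choose k) * bernoulli k * x ^ (n - k))"

(* The generic cong is useless on the field rat, where the remainder modulo a nonzero
   element is always 0; here the difference must be an integer multiple of the modulus. *)
definition rat_cong :: "rat \<Rightarrow> rat \<Rightarrow> nat \<Rightarrow> bool" where
  "rat_cong a b m \<longleftrightarrow> (\<exists>k::int. a - b = of_int k * of_nat m)"

lemma bernoulli_1: "bernoulli 1 = - 1 / 2"
  by simp

lemma bernoulli_poly_0: "bernoulli_poly n 0 = bernoulli n"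
proof -
  have "bernoulli_poly n 0 = (\<Sum>k=0..n. if k = n then bernoulli n else 0)"
    unfolding bernoulli_poly_def by (rule sum.cong) (auto simp: power_0_left)
  then show ?thesis by simp
qed

end

theory Submission
  imports Defs "HOL-Number_Theory.Cong"
begin

text \<open>
  The identity \<open>B\<^sub>m(x + 1) - B\<^sub>m(x) = m x^(m-1)\<close> telescopes to Faulhaber's formula, so the left-hand
  side equals \<open>2 S / p + p^(p-1)\<close>, where \<open>S\<close> is the sum of \<open>k^p\<close> over \<open>k < p\<close>. Reversing the order of
  summation, \<open>2 S\<close> is the sum of \<open>k^p + (p - k)^p\<close> over \<open>0 < k < p\<close>, and each of these terms is
  divisible by \<open>p^2\<close> because \<open>p\<close> is odd and \<open>k \<equiv> - (p - k)\<close> modulo \<open>p\<close>.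
\<close>

text \<open>For \<open>n >= 2\<close> the defining recurrence makes the terms with
  \<open>k < n\<close> cancel. The correction at \<open>n = 1\<close> comes from
  \<open>B_1 = -1/2\<close>: there the sum is \<open>1 - 1/2 = B_1 + 1\<close>.\<close>

lemma sum_binomial_bernoulli:
  "(\<Sum>k\<le>n. of_nat (n choose k) * bernoulli k) = bernoulli n + (if n = 1 then 1 else 0)"
proof (cases n)
  case (Suc m)
  show ?thesis
  proof (cases m)
    case (Suc l)
    have "(\<Sum>k\<le>m. of_nat (n choose k) * bernoulli k) = 0"
    proof -
      have "(\<Sum>k\<le>l. of_nat (n choose k) * bernoulli k) = - (of_nat n * bernoulli m)"
        using \<open>n = Suc m\<close> Suc by (simp add: field_simps del: binomial_Suc_Suc of_nat_Suc)
      moreover have "n choose m = n"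
        using \<open>n = Suc m\<close> by simp
      ultimately show ?thesis
        using Suc by (simp del: binomial_Suc_Suc bernoulli.simps)
    qed
    then show ?thesis
      using \<open>n = Suc m\<close> Suc by (simp del: binomial_Suc_Suc bernoulli.simps)
  qed (simp add: \<open>n = Suc m\<close>)
qed simp

lemma bernoulli_poly_reversed:
  "bernoulli_poly n x = (\<Sum>j\<le>n. of_nat (n choose j) * bernoulli (n - j) * x ^ j)"
  unfolding bernoulli_poly_def atLeast0AtMost
  by (subst sum.nat_diff_reindex[symmetric, of _ "Suc n", simplified lessThan_Suc_atMost])
     (auto intro!: sum.cong simp: binomial_symmetric[symmetric])

text \<open>Expand each power of \<open>x + 1\<close> and collect by powers of \<open>x\<close>: the
  coefficient of \<open>x ^ j\<close> is \<open>m choose j\<close> times the sum in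
  \<open>sum_binomial_bernoulli\<close> at \<open>m - j\<close>. Its correction appears only for
  \<open>m - j = 1\<close>, that is \<open>j = n\<close>, and yields the extra term.\<close>

lemma bernoulli_poly_add_1:
  "bernoulli_poly (Suc n) (x + 1) = bernoulli_poly (Suc n) x + of_nat (Suc n) * x ^ n"
proof -
  define m where "m = Suc n"
  have "bernoulli_poly m (x + 1) =
      (\<Sum>k\<le>m. \<Sum>j\<le>m - k. of_nat (m choose k) * bernoulli k * (of_nat (m - k choose j) * x ^ j))"
    unfolding bernoulli_poly_def atLeast0AtMost
    by (simp add: binomial_ring sum_distrib_left)
  also have "\<dots> =
      (\<Sum>j\<le>m. \<Sum>k\<le>m - j. of_nat (m choose k) * bernoulli k * (of_nat (m - k choose j) * x ^ j))"
  proof -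
    have "(SIGMA k:{..m}. {..m - k}) = {(k, j). k + j \<le> m}"
      by auto
    then show ?thesis
      by (simp add: sum.Sigma)
         (rule sum.reindex_bij_witness[of _ prod.swap prod.swap]; auto)
  qed
  also have "\<dots> = (\<Sum>j\<le>m. of_nat (m choose j) * x ^ j *
      (\<Sum>k\<le>m - j. of_nat (m - j choose k) * bernoulli k))"
  proof (rule sum.cong[OF refl])
    fix j assume "j \<in> {..m}"
    \<comment> \<open>Both products equal \<open>(m choose (k + j)) * ((k + j) choose k)\<close>:
      they count pairs of disjoint subsets of sizes \<open>k\<close> and \<open>j\<close>.\<close>
    have "(m choose k) * (m - k choose j) = (m choose j) * (m - j choose k)" if "k \<le> m - j" for k
      using choose_mult[of k "k + j" m] choose_mult[of j "k + j" m] that \<open>j \<in> {..m}\<close>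
        binomial_symmetric[of k "k + j"] by (simp add: add.commute le_diff_conv2)
    then have "of_nat (m choose k) * of_nat (m - k choose j) =
        (of_nat (m choose j) * of_nat (m - j choose k) :: rat)" if "k \<le> m - j" for k
      using that by (metis of_nat_mult)
    then show "(\<Sum>k\<le>m - j. of_nat (m choose k) * bernoulli k * (of_nat (m - k choose j) * x ^ j)) =
        of_nat (m choose j) * x ^ j * (\<Sum>k\<le>m - j. of_nat (m - j choose k) * bernoulli k)"
      unfolding sum_distrib_left by (intro sum.cong[OF refl]) (simp add: mult_ac)
  qed
  also have "\<dots> = (\<Sum>j\<le>m. of_nat (m choose j) * bernoulli (m - j) * x ^ j +
      (if j = n then of_nat (m choose j) * x ^ j else 0))"
    unfolding sum_binomial_bernoulli
    by (intro sum.cong[OF refl]) (auto simp: m_def algebra_simps)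
  also have "\<dots> = bernoulli_poly m x + of_nat m * x ^ n"
    by (simp add: sum.distrib bernoulli_poly_reversed m_def)
  finally show ?thesis
    by (simp only: m_def)
qed

lemma bernoulli_poly_of_nat:
  "bernoulli_poly (Suc n) (of_nat N) =
    bernoulli (Suc n) + of_nat (Suc n) * of_nat (\<Sum>k<N. k ^ n)"
proof (induction N)
  case 0
  then show ?case by (simp only: bernoulli_poly_0 of_nat_0 lessThan_0 sum.empty)
next
  case (Suc N)
  have "bernoulli_poly (Suc n) (of_nat (Suc N)) = bernoulli_poly (Suc n) (of_nat N + 1)"
    by (simp add: add.commute)
  also have "\<dots> = bernoulli (Suc n) + of_nat (Suc n) * of_nat (\<Sum>k<Suc N. k ^ n)"
    unfolding bernoulli_poly_add_1 Suc.IH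
    by (simp add: algebra_simps del: bernoulli.simps of_nat_Suc)
  finally show ?case .
qed

text \<open>Factor out \<open>x - y\<close>, which supplies one factor \<open>n\<close>. The
  cofactor has \<open>n\<close> summands, each congruent to \<open>y ^ (n - 1)\<close> modulo
  \<open>n\<close>, and so supplies the other.\<close>

lemma power_diff_square_dvd:
  fixes x y :: int
  assumes "int n dvd x - y"
  shows "int n ^ 2 dvd x ^ n - y ^ n"
proof -
  have "[x = y] (mod int n)"
    using assms by (simp add: cong_iff_dvd_diff)
  then have "[(\<Sum>i<n. y ^ (n - Suc i) * x ^ i) = (\<Sum>i<n. y ^ (n - Suc i) * y ^ i)] (mod int n)"
    by (intro cong_sum cong_mult cong_pow cong_refl)
  also have "(\<Sum>i<n. y ^ (n - Suc i) * y ^ i) = int n * y ^ (n - 1)"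
    by (simp flip: power_add)
  finally have "int n dvd (\<Sum>i<n. y ^ (n - Suc i) * x ^ i)"
    by (simp add: cong_dvd_iff)
  then show ?thesis
    using assms unfolding power_diff_sumr2 power2_eq_square by (rule mult_dvd_mono[rotated])
qed

lemma square_dvd_double_sum_powers:
  assumes "odd n"
  shows "n ^ 2 dvd 2 * (\<Sum>k<n. k ^ n)"
proof -
  have "n > 0" using assms by (rule odd_pos)
  \<comment> \<open>Without the vanishing term at 0, the index range is stable under
    \<open>k \<mapsto> n - k\<close>.\<close>
  then have *: "(\<Sum>k<n. k ^ n) = (\<Sum>k=1..<n. k ^ n)"
    by (simp add: lessThan_atLeast0 sum.atLeast_Suc_lessThan)
  have "(\<Sum>k=1..<n. k ^ n) = (\<Sum>k=1..<n. (n - k) ^ n)"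
    by (rule sum.reindex_bij_witness[of _ "\<lambda>k. n - k" "\<lambda>k. n - k"]) auto
  then have "2 * (\<Sum>k<n. k ^ n) = (\<Sum>k=1..<n. k ^ n + (n - k) ^ n)"
    unfolding sum.distrib * by simp
  also have "n ^ 2 dvd \<dots>"
  proof (rule dvd_sum)
    fix k assume "k \<in> {1..<n}"
    \<comment> \<open>The bases \<open>k\<close> and \<open>-(n - k)\<close> differ by exactly
      \<open>n\<close>; oddness of the exponent then turns the difference of powers into a
      sum.\<close>
    then have "int n ^ 2 dvd int k ^ n - (- int (n - k)) ^ n"
      by (intro power_diff_square_dvd) (simp add: of_nat_diff)
    also have "\<dots> = int (k ^ n + (n - k) ^ n)"
      using assms by simp
    finally show "n ^ 2 dvd k ^ n + (n - k) ^ n"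
      by (metis of_nat_dvd_iff of_nat_power)
  qed
  finally show ?thesis .
qed

theorem theorem2:
  fixes p :: nat
  assumes "prime p" and "odd p"
  shows "rat_cong
    ((bernoulli_poly (p + 1) (of_nat (p + 1)) + bernoulli_poly (p + 1) (of_nat p)
        - 2 * bernoulli (p + 1)) / (of_nat p * of_nat (p + 1)))
    (of_nat p ^ (p - 1)) p"
proof -
  define S where "S = (\<Sum>k<p. k ^ p)"
  have "p > 0" using assms(2) by (rule odd_pos)
  obtain c where c: "2 * S = p ^ 2 * c"
    using square_dvd_double_sum_powers[OF assms(2)] unfolding S_def by (rule dvdE)
  \<comment> \<open>The power sums up to \<open>p + 1\<close> and \<open>p\<close> are
    \<open>S + p ^ p\<close> and \<open>S\<close>; the constants \<open>bernoulli (p + 1)\<close>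
    cancel.\<close>
  have "bernoulli_poly (p + 1) (of_nat (p + 1)) + bernoulli_poly (p + 1) (of_nat p)
      - 2 * bernoulli (p + 1) = of_nat (p + 1) * of_nat (2 * S + p ^ p)"
    unfolding Suc_eq_plus1[symmetric] bernoulli_poly_of_nat S_def
    by (simp add: algebra_simps del: bernoulli.simps of_nat_Suc)
  also have "2 * S + p ^ p = p * (p * c + p ^ (p - 1))"
    using \<open>p > 0\<close> c by (simp add: power2_eq_square algebra_simps flip: power_Suc)
  finally have "(bernoulli_poly (p + 1) (of_nat (p + 1)) + bernoulli_poly (p + 1) (of_nat p)
      - 2 * bernoulli (p + 1)) / (of_nat p * of_nat (p + 1)) =
      of_nat c * of_nat p + of_nat p ^ (p - 1)"
    using \<open>p > 0\<close> by (simp add: divide_simps del: bernoulli.simps of_nat_Suc)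
  then show ?thesis
    unfolding rat_cong_def by (intro exI[of _ "int c"]) simp
qed

end
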